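(* Let $X$ be a locally compact space that is countable at infinity (i.e. $\sigma$-compact), let $\mu\in\mathcal M^+(X)$, and fix points $x,y\in X$. Let $\mathfrak a=\mathfrak a_x^y\colon X\to X$ be a map satisfying: (A) $\mathfrak a$ is $\mu$-measurable and $\mu(\mathfrak a^{-1}K)<+\infty$ for every compact $K\subset X$; $\mathfrak a(x)=y$; and $\mathfrak a\mu=\mu$ (the measure $\mu$ is invariant under $\mathfrak a$). Let $U$ be a class of upper semicontinuous functions $u\colon X\to[-\infty,+\infty)$ that is closed under pointwise addition and invariant under $\mathfrak a$, i.e. $u\circ\mathfrak a\in U$ for every $u\in U$, and suppose there is a function $\mathsf u\in U$ with $\mathsf u(x)\neq-\infty$. Let $v\colon X\to\mathbb R$ be a continuous function with $v-v\circ\mathfrak a\in U$. Let $\Phi\colon\mathbb R\to(0,+\infty)$, $q\colon\mathbb R\to(0,+\infty)$, $Q\colon(0,+\infty)\to(0,+\infty)$ be continuous functions that extend by continuity, with values in $[0,+\infty]$, to the points $\pm\infty$ (for $\Phi$ and $q$) and to the points $0,+\infty$ (for $Q$). For $u\in U$ put $$\|u\|:=Q\Bigl(\int_X\Phi\circ(u-v)\,d\mu\Bigr),\qquad \|\delta_x\|^*:=\sup\Bigl\{\frac{q(\mathsf u(x))}{\|\mathsf u\|}\;:\;\mathsf u\in U,\ 0<\|\mathsf u\|<+\infty\Bigr\}.$$ Then: (1) For every $u\in U$ with $\int_X\Phi\circ(u-v)\,d\mu\in(0,+\infty)$, $$q\bigl(u(y)-v(y)+v(x)\bigr)\le\|\delta_x\|^*\cdot\|u\|.$$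 (2) If, in addition, $v\circ\mathfrak a-v\in U$ (that is, $v-v\circ\mathfrak a\in U\cap(-U)$, where $-U:=\{-u:u\in U\}$) and the map $\mathsf u\mapsto\mathsf u\circ\mathfrak a$ is a surjection of $U$ onto $U$, then the estimate in (1) is sharp, i.e. $$\sup\Bigl\{\frac{q\bigl(u(y)-v(y)+v(x)\bigr)}{\|u\|}\;:\;u\in U,\ 0<\|u\|<+\infty\Bigr\}=\|\delta_x\|^*.$$
   Context: $\mathcal M^+(X)$ is the cone of positive Borel (Radon) measures on $X$. For a map $\mathfrak a\colon X\to X$ satisfying (A), the image measure $\mathfrak a\mu\in\mathcal M^+(X)$ is defined by $(\mathfrak a\mu)(K)=\mu(\mathfrak a^{-1}K)$ for compact $K\subset X$. The continuous extensions of $\Phi,q,Q$ are denoted by the same letters; they are used where $u$ takes the value $-\infty$ (so that $\Phi(-\infty),q(-\infty)\in[0,+\infty]$) and where the integral of $\Phi\circ(u-v)\ge0$ equals $0$ or $+\infty$. The expressions $\|u\|$ and $\|\delta_x\|^*$ take values in $[0,+\infty]$; they are only notation (analogues of quasinorms), with no norm axioms assumed. *)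

theory Defs
  imports "HOL-Analysis.Analysis"
begin

definition sigma_compact_space :: "'a::topological_space itself \<Rightarrow> bool" where
  "sigma_compact_space _ \<longleftrightarrow>
     (\<exists>K :: nat \<Rightarrow> 'a set. (\<forall>n. compact (K n)) \<and> (\<Union>n. K n) = UNIV)"

(* On a sigma-compact locally compact Hausdorff space, inner regularity on all Borel sets
   agrees with the other usual convention (outer regular on Borel sets, inner regular on
   open sets). *)
definition radon_measure :: "'a::t2_space measure \<Rightarrow> bool" where
  "radon_measure \<mu> \<longleftrightarrow>
     sets \<mu> = sets borel \<and>
     (\<forall>K. compact K \<longrightarrow> emeasure \<mu> K < \<infinity>) \<and>
     (\<forall>B \<in> sets borel. emeasure \<mu> B = (SUP K \<in> {K. compact K \<and> K \<subseteq> B}. emeasure \<mu> K))"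

(* The completion is needed because a mu-measurable map
   pulls Borel sets back to mu-measurable sets, which need not be Borel. *)
definition admissible_map :: "'a::t2_space measure \<Rightarrow> ('a \<Rightarrow> 'a) \<Rightarrow> bool" where
  "admissible_map \<mu> a \<longleftrightarrow>
     a \<in> completion \<mu> \<rightarrow>\<^sub>M borel \<and>
     (\<forall>K. compact K \<longrightarrow> emeasure (completion \<mu>) (a -` K) < \<infinity>)"

(* "nu is the image measure of mu under a": the Radon measure prescribed by its values
   on compact sets; invariance of mu under a is is_image_measure a mu mu. *)
definition is_image_measure ::
    "('a::t2_space \<Rightarrow> 'a) \<Rightarrow> 'a measure \<Rightarrow> 'a measure \<Rightarrow> bool" where
  "is_image_measure a \<mu> \<nu> \<longleftrightarrow>
     radon_measure \<nu> \<and>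
     (\<forall>K. compact K \<longrightarrow> emeasure \<nu> K = emeasure (completion \<mu>) (a -` K))"

definition upper_semicontinuous :: "('a::topological_space \<Rightarrow> ereal) \<Rightarrow> bool" where
  "upper_semicontinuous u \<longleftrightarrow> (\<forall>c. open {z. u z < c})"

(* Functions R -> (0,+oo) that extend continuously to [-oo,+oo] with values in [0,+oo] are
   represented by their extension. *)
definition positive_on_reals :: "(ereal \<Rightarrow> ennreal) \<Rightarrow> bool" where
  "positive_on_reals f \<longleftrightarrow>
     continuous_on UNIV f \<and> (\<forall>t::real. 0 < f (ereal t) \<and> f (ereal t) < \<infinity>)"

(* Likewise for functions (0,+oo) -> (0,+oo), represented on [0,+oo]. *)
definition positive_on_halfline :: "(ennreal \<Rightarrow> ennreal) \<Rightarrow> bool" where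
  "positive_on_halfline f \<longleftrightarrow>
     continuous_on UNIV f \<and> (\<forall>t. 0 < t \<and> t < \<infinity> \<longrightarrow> 0 < f t \<and> f t < \<infinity>)"

definition weighted_integral ::
    "(ereal \<Rightarrow> ennreal) \<Rightarrow> ('a \<Rightarrow> real) \<Rightarrow> 'a measure \<Rightarrow> ('a \<Rightarrow> ereal) \<Rightarrow> ennreal" where
  "weighted_integral \<Phi> v \<mu> u = (\<integral>\<^sup>+ z. \<Phi> (u z - ereal (v z)) \<partial>\<mu>)"

definition unorm ::
    "(ennreal \<Rightarrow> ennreal) \<Rightarrow> (ereal \<Rightarrow> ennreal) \<Rightarrow> ('a \<Rightarrow> real) \<Rightarrow> 'a measure \<Rightarrow> ('a \<Rightarrow> ereal) \<Rightarrow> ennreal"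
  where
  "unorm Q \<Phi> v \<mu> u = Q (weighted_integral \<Phi> v \<mu> u)"

(* The supremum is taken in [0,+oo]; it is 0 if no u qualifies. *)
definition delta_norm ::
    "('a \<Rightarrow> ereal) set \<Rightarrow> (ereal \<Rightarrow> ennreal) \<Rightarrow> (ennreal \<Rightarrow> ennreal) \<Rightarrow> (ereal \<Rightarrow> ennreal)
      \<Rightarrow> ('a \<Rightarrow> real) \<Rightarrow> 'a measure \<Rightarrow> 'a \<Rightarrow> ennreal" where
  "delta_norm U q Q \<Phi> v \<mu> x =
     Sup {q (u x) / unorm Q \<Phi> v \<mu> u | u. u \<in> U \<and> 0 < unorm Q \<Phi> v \<mu> u \<and> unorm Q \<Phi> v \<mu> u < \<infinity>}"

end

(* Transport along a: send u in U to w = u o a + (v - v o a), again in U. Then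
   w - v = (u - v) o a, so u and w have the same integral by invariance of the measure, while
   w x = u y - v y + v x. If also v o a - v lies in U and composition with a is onto U, then
   every w in U arises in this way, so both suprema run over the same set of quotients. *)
theory Submission
  imports Defs
begin

lemma upper_semicontinuous_borel_measurable:
  assumes "upper_semicontinuous u"
  shows "u \<in> borel_measurable borel"
proof (rule borel_measurableI_less)
  fix c
  show "{z \<in> space borel. u z < c} \<in> sets borel"
    using assms by (simp add: upper_semicontinuous_def)
qed

text \<open>A closed set is the countable union of its intersections with the members of a countable
  compact cover, and these are compact. Compact sets thus generate the Borel sets, so measures
  prescribed on compact sets can be compared on all Borel sets.\<close>

lemma sets_borel_eq_sigma_compact_sets:
  assumes "sigma_compact_space TYPE('a::t2_space)"
  shows "sets (borel :: 'a measure) = sigma_sets UNIV {K. compact K}"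
proof -
  obtain L :: "nat \<Rightarrow> 'a set" where L: "\<And>n. compact (L n)" "(\<Union>n. L n) = UNIV"
    using assms by (auto simp: sigma_compact_space_def)
  have "sigma_sets UNIV {C. closed C} = sigma_sets UNIV {K :: 'a set. compact K}"
  proof (rule sigma_sets_eqI)
    fix C :: "'a set" assume "C \<in> {C. closed C}"
    then have "compact (C \<inter> L n)" for n
      using L(1) by (simp add: closed_Int_compact)
    then have "(\<Union>n. C \<inter> L n) \<in> sigma_sets UNIV {K. compact K}"
      by (intro sigma_sets.Union sigma_sets.Basic) simp
    also have "(\<Union>n. C \<inter> L n) = C"
      using L(2) by blast
    finally show "C \<in> sigma_sets UNIV {K. compact K}" .
  qed (auto intro: compact_imp_closed sigma_sets.Basic)
  then show ?thesis
    by (simp add: borel_eq_closed)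
qed

text \<open>The image measure is prescribed on compact sets only. These form a generator closed
  under intersection, and the countable compact cover consists of sets of finite
  \<open>\<nu>\<close>-measure, so the uniqueness theorem for measures extends the agreement to all
  Borel sets.\<close>

lemma distr_completion_eq:
  fixes \<mu> \<nu> :: "'a::t2_space measure"
  assumes "sigma_compact_space TYPE('a)"
    and "a \<in> completion \<mu> \<rightarrow>\<^sub>M borel"
    and "space \<mu> = UNIV"
    and "is_image_measure a \<mu> \<nu>"
  shows "distr (completion \<mu>) borel a = \<nu>"
proof -
  obtain L :: "nat \<Rightarrow> 'a set" where L: "\<And>n. compact (L n)" "(\<Union>n. L n) = UNIV"
    using assms(1) by (auto simp: sigma_compact_space_def)
  have \<nu>: "sets \<nu> = sets borel" "\<And>K. compact K \<Longrightarrow> emeasure \<nu> K < \<infinity>"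
    "\<And>K. compact K \<Longrightarrow> emeasure \<nu> K = emeasure (completion \<mu>) (a -` K)"
    using assms(4) by (auto simp: is_image_measure_def radon_measure_def)
  have dist: "emeasure (distr (completion \<mu>) borel a) K = emeasure \<nu> K" if "compact K" for K
    using that assms(2,3) \<nu>(3)
    by (simp add: emeasure_distr borel_closed compact_imp_closed)
  show ?thesis
  proof (rule measure_eqI_generator_eq[where E = "{K. compact K}" and A = L and \<Omega> = UNIV])
    show "Int_stable {K :: 'a set. compact K}"
      by (auto simp: Int_stable_def intro: compact_Int)
    show "emeasure (distr (completion \<mu>) borel a) (L i) \<noteq> \<infinity>" for i
      using dist \<nu>(2) L(1) by (simp add: less_top)
  qed (use L dist \<nu>(1) sets_borel_eq_sigma_compact_sets[OF assms(1)] in auto)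
qed

text \<open>Change of variables. The function \<open>f\<close> composed with \<open>a\<close> is
  measurable for the completion but perhaps not Borel; passing to the completion leaves the
  nonnegative integral unchanged, and there the formula for \<open>distr\<close> applies.\<close>

lemma nn_integral_comp_image_measure:
  fixes \<mu> \<nu> :: "'a::t2_space measure"
  assumes "sigma_compact_space TYPE('a)"
    and "a \<in> completion \<mu> \<rightarrow>\<^sub>M borel"
    and "space \<mu> = UNIV"
    and "is_image_measure a \<mu> \<nu>"
    and "f \<in> borel_measurable borel"
  shows "(\<integral>\<^sup>+ z. f (a z) \<partial>\<mu>) = (\<integral>\<^sup>+ z. f z \<partial>\<nu>)"
proof -
  have "(\<integral>\<^sup>+ z. f (a z) \<partial>\<mu>) = (\<integral>\<^sup>+ z. f (a z) \<partial>completion \<mu>)"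
    by (simp add: nn_integral_completion)
  also have "\<dots> = (\<integral>\<^sup>+ z. f z \<partial>distr (completion \<mu>) borel a)"
    using assms(2,5) by (simp add: nn_integral_distr)
  finally show ?thesis
    using distr_completion_eq[OF assms(1-4)] by simp
qed

theorem mainTheorem1:
  fixes \<mu> :: "'a::t2_space measure"
    and x y :: 'a
    and a :: "'a \<Rightarrow> 'a"
    and U :: "('a \<Rightarrow> ereal) set"
    and v :: "'a \<Rightarrow> real"
    and \<Phi> q :: "ereal \<Rightarrow> ennreal"
    and Q :: "ennreal \<Rightarrow> ennreal"
  assumes X_locally_compact: "locally_compact_space (euclidean :: 'a topology)"
    and X_sigma_compact: "sigma_compact_space TYPE('a)"
    and \<mu>_radon: "radon_measure \<mu>"
    and a_admissible: "admissible_map \<mu> a"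
    and a_maps: "a x = y"
    and a_invariant: "is_image_measure a \<mu> \<mu>"
    and U_usc: "\<forall>u\<in>U. upper_semicontinuous u \<and> (\<forall>z. u z \<noteq> \<infinity>)"
    and U_add: "\<forall>u\<in>U. \<forall>w\<in>U. (\<lambda>z. u z + w z) \<in> U"
    and U_invariant: "\<forall>u\<in>U. u \<circ> a \<in> U"
    and U_nontrivial: "\<exists>u\<in>U. u x \<noteq> -\<infinity>"
    and v_cont: "continuous_on UNIV v"
    and v_diff: "(\<lambda>z. ereal (v z - v (a z))) \<in> U"
    and \<Phi>: "positive_on_reals \<Phi>"
    and q: "positive_on_reals q"
    and Q: "positive_on_halfline Q"
  shows "(\<forall>u\<in>U. 0 < weighted_integral \<Phi> v \<mu> u \<and> weighted_integral \<Phi> v \<mu> u < \<infinity> \<longrightarrow>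
            q (u y - ereal (v y) + ereal (v x)) \<le> delta_norm U q Q \<Phi> v \<mu> x * unorm Q \<Phi> v \<mu> u)
       \<and> ((\<lambda>z. ereal (v (a z) - v z)) \<in> U \<and> (\<lambda>u. u \<circ> a) ` U = U \<longrightarrow>
            Sup {q (u y - ereal (v y) + ereal (v x)) / unorm Q \<Phi> v \<mu> u | u.
                   u \<in> U \<and> 0 < unorm Q \<Phi> v \<mu> u \<and> unorm Q \<Phi> v \<mu> u < \<infinity>}
              = delta_norm U q Q \<Phi> v \<mu> x)"
proof -
  have sp: "space \<mu> = UNIV"
    using \<mu>_radon sets_eq_imp_space_eq[of \<mu> borel] by (simp add: radon_measure_def)
  have a_meas: "a \<in> completion \<mu> \<rightarrow>\<^sub>M borel"
    using a_admissible by (simp add: admissible_map_def)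
  \<comment> \<open>The relation says that w - v is (u - v) composed with \<open>a\<close>. Stating
    it for any such pair lets the same fact serve both when w is built from u and when u is
    recovered from w.\<close>
  have integral_eq: "weighted_integral \<Phi> v \<mu> w = weighted_integral \<Phi> v \<mu> u"
    if "u \<in> U" and w: "\<And>z. w z - ereal (v z) = u (a z) - ereal (v (a z))" for u w
  proof -
    have [measurable]: "u \<in> borel_measurable borel" "v \<in> borel_measurable borel"
      "\<Phi> \<in> borel_measurable borel"
      using U_usc \<open>u \<in> U\<close> v_cont \<Phi>
      by (auto simp: positive_on_reals_def
          intro: upper_semicontinuous_borel_measurable borel_measurable_continuous_onI)
    have "(\<lambda>z. \<Phi> (u z - ereal (v z))) \<in> borel_measurable borel"
      by measurable
    from nn_integral_comp_image_measure[OF X_sigma_compact a_meas sp a_invariant this]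
    show ?thesis
      by (simp add: weighted_integral_def w)
  qed
  have pull: "\<exists>w\<in>U. w x = u y - ereal (v y) + ereal (v x) \<and>
      weighted_integral \<Phi> v \<mu> w = weighted_integral \<Phi> v \<mu> u" if "u \<in> U" for u
  proof (intro bexI conjI)
    let ?w = "\<lambda>z. (u \<circ> a) z + ereal (v z - v (a z))"
    show "?w \<in> U"
      using U_add[rule_format, OF U_invariant[rule_format, OF that] v_diff] .
    \<comment> \<open>The value of u may be infinite, so the terms in v are rearranged by cases:
      adding or subtracting a real leaves an infinite value as it is.\<close>
    show "?w x = u y - ereal (v y) + ereal (v x)"
      using a_maps by (cases "u y") auto
    show "weighted_integral \<Phi> v \<mu> ?w = weighted_integral \<Phi> v \<mu> u"
    proof (rule integral_eq[OF that])
      show "?w z - ereal (v z) = u (a z) - ereal (v (a z))" for z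
        by (cases "u (a z)") auto
    qed
  qed
  have push: "\<exists>u\<in>U. w x = u y - ereal (v y) + ereal (v x) \<and>
      weighted_integral \<Phi> v \<mu> w = weighted_integral \<Phi> v \<mu> u"
    if v_diff': "(\<lambda>z. ereal (v (a z) - v z)) \<in> U" and onto: "(\<lambda>u. u \<circ> a) ` U = U"
      and "w \<in> U" for w
  proof -
    \<comment> \<open>Solve w = u o a + (v - v o a) for u o a: the solution lies in U by
      \<open>v_diff'\<close> and additivity, and surjectivity of composition with \<open>a\<close>
      supplies u itself.\<close>
    have "(\<lambda>z. w z + ereal (v (a z) - v z)) \<in> (\<lambda>u. u \<circ> a) ` U"
      using U_add[rule_format, OF \<open>w \<in> U\<close> v_diff'] onto by simp
    then obtain u where "u \<in> U" and u: "\<And>z. u (a z) = w z + ereal (v (a z) - v z)"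
      by (auto simp: fun_eq_iff)
    have "w x = u y - ereal (v y) + ereal (v x)"
      using u[of x] a_maps by (cases "w x") auto
    moreover have "w z - ereal (v z) = u (a z) - ereal (v (a z))" for z
      using u[of z] by (cases "w z") auto
    ultimately show ?thesis
      using integral_eq \<open>u \<in> U\<close> by blast
  qed
  show ?thesis
  proof (intro conjI ballI impI)
    fix u assume "u \<in> U"
      and I: "0 < weighted_integral \<Phi> v \<mu> u \<and> weighted_integral \<Phi> v \<mu> u < \<infinity>"
    let ?N = "unorm Q \<Phi> v \<mu> u"
    have N: "0 < ?N" "?N < \<infinity>"
      using Q I by (auto simp: positive_on_halfline_def unorm_def)
    obtain w where w: "w \<in> U" "w x = u y - ereal (v y) + ereal (v x)"
        "unorm Q \<Phi> v \<mu> w = ?N"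
      using pull[OF \<open>u \<in> U\<close>] by (auto simp: unorm_def)
    have "q (w x) / ?N \<le> delta_norm U q Q \<Phi> v \<mu> x"
      unfolding delta_norm_def by (rule Sup_upper) (use w N in force)
    then have "q (w x) / ?N * ?N \<le> delta_norm U q Q \<Phi> v \<mu> x * ?N"
      by (rule mult_right_mono) simp
    \<comment> \<open>Cancellation in \<open>ennreal\<close> relies on the divisor being neither 0
      nor infinite.\<close>
    moreover have "q (w x) / ?N * ?N = q (w x)"
      using N by (simp add: ennreal_divide_times ennreal_mult_divide_eq less_top)
    ultimately show "q (u y - ereal (v y) + ereal (v x)) \<le> delta_norm U q Q \<Phi> v \<mu> x * ?N"
      using w(2) by simp
  next
    assume H: "(\<lambda>z. ereal (v (a z) - v z)) \<in> U \<and> (\<lambda>u. u \<circ> a) ` U = U"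
    have "{q (u y - ereal (v y) + ereal (v x)) / unorm Q \<Phi> v \<mu> u | u.
             u \<in> U \<and> 0 < unorm Q \<Phi> v \<mu> u \<and> unorm Q \<Phi> v \<mu> u < \<infinity>} =
          {q (u x) / unorm Q \<Phi> v \<mu> u | u.
             u \<in> U \<and> 0 < unorm Q \<Phi> v \<mu> u \<and> unorm Q \<Phi> v \<mu> u < \<infinity>}" (is "?A = ?B")
    \<comment> \<open>\<open>pull\<close> and \<open>push\<close> give the two inclusions. Both
      preserve the integral, hence the norm, so the bounds on the norm carry over together with the
      quotient.\<close>
    proof (intro subset_antisym subsetI)
      fix r assume "r \<in> ?A"
      then obtain u where "u \<in> U" and u: "0 < unorm Q \<Phi> v \<mu> u" "unorm Q \<Phi> v \<mu> u < \<infinity>"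
        "r = q (u y - ereal (v y) + ereal (v x)) / unorm Q \<Phi> v \<mu> u" by blast
      from pull[OF \<open>u \<in> U\<close>] obtain w where "w \<in> U" "w x = u y - ereal (v y) + ereal (v x)"
        "unorm Q \<Phi> v \<mu> w = unorm Q \<Phi> v \<mu> u" by (auto simp: unorm_def)
      with u show "r \<in> ?B" by force
    next
      fix r assume "r \<in> ?B"
      then obtain w where "w \<in> U" and w: "0 < unorm Q \<Phi> v \<mu> w" "unorm Q \<Phi> v \<mu> w < \<infinity>"
        "r = q (w x) / unorm Q \<Phi> v \<mu> w" by blast
      from push[OF _ _ \<open>w \<in> U\<close>] H obtain u where "u \<in> U"
        "w x = u y - ereal (v y) + ereal (v x)"
        "unorm Q \<Phi> v \<mu> w = unorm Q \<Phi> v \<mu> u" by (auto simp: unorm_def)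
      with w show "r \<in> ?A" by force
    qed
    then show "Sup ?A = delta_norm U q Q \<Phi> v \<mu> x"
      by (simp add: delta_norm_def)
  qed
qed

end
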